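(* Let $k$ and $l$ be integers with $2 \leq k < l$ and let $S = kl + k - 1$. Suppose the real numbers in $[1,S]$ are colored red and blue so that $1$ is blue and $2$ and $l+1$ are red. Then there is a red solution to $x_1 + x_2 + \cdots + x_k = x_0$ or a blue solution to $x_1 + x_2 + \cdots + x_l = x_0$ (with all $x_i \in [1,S]$).
   Context: A red (resp. blue) solution to an equation means numbers $x_0, x_1, \dots$ in the colored interval satisfying the equation, all colored red (resp. blue); the variables need not be distinct. *)

theory Defs
  imports Complex_Main
begin

datatype colour = Red | Blue

text \<open>
  A colouring of \<open>[1,S]\<close> is a function on all of \<open>real\<close>; its values outside \<open>[1,S]\<close> are
  irrelevant, because solutions are required to lie in the interval.
\<close>

definition mono_solution ::
    "(real \<Rightarrow> colour) \<Rightarrow> real \<Rightarrow> colour \<Rightarrow> nat \<Rightarrow> (nat \<Rightarrow> real) \<Rightarrow> bool" where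
  "mono_solution c S col m x \<longleftrightarrow>
     (\<forall>i\<le>m. x i \<in> {1..S} \<and> c (x i) = col) \<and> (\<Sum>i=1..m. x i) = x 0"

end

theory Submission imports Defs begin

text \<open>
  Assume there is no solution of either kind. Since \<open>1\<close> is blue, \<open>l\<close> is red; since \<open>l\<close> and
  \<open>l + 1\<close> are red, \<open>kl\<close> and \<open>kl + k - 1 = (k - 1)(l + 1) + l\<close> are blue. As \<open>kl\<close> is \<open>l\<close> copies
  of \<open>k\<close>, the number \<open>k\<close> is red. As \<open>kl + k - 1\<close> is \<open>(k - 1)l + k\<close> plus \<open>l - 1\<close> ones,
  \<open>(k - 1)l + k\<close> is red too, yet it is the sum of \<open>k - 1\<close> copies of \<open>l\<close> and one \<open>k\<close>.
\<close>

text \<open>Every solution needed below has \<open>m - 1\<close> equal summands;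
  \<open>u = v\<close> is allowed, which covers \<open>m\<close> equal ones.\<close>

lemma ex_mono_solution_two_values:
  assumes "1 \<le> m"
    and "u \<in> {1..S}" "v \<in> {1..S}" "w \<in> {1..S}"
    and "c u = col" "c v = col" "c w = col"
    and "(real m - 1) * u + v = w"
  shows "\<exists>x. mono_solution c S col m x"
proof -
  define x where "x i = (if i = 0 then w else if i = m then v else u)" for i :: nat
  obtain n where m: "m = Suc n"
    using assms(1) by (cases m) auto
  have "(\<Sum>i=1..n. x i) = (\<Sum>i=1..n. u)"
    by (rule sum.cong) (auto simp: x_def m)
  hence "(\<Sum>i=1..m. x i) = x 0"
    using assms(8) by (simp add: m x_def)
  thus ?thesis
    unfolding mono_solution_def using assms by (intro exI[of _ x]) (auto simp: x_def)
qed

lemma colour_neq_Red_iff: "col \<noteq> Red \<longleftrightarrow> col = Blue"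
  by (cases col) auto

theorem theorem2:
  fixes k l :: nat and S :: real and c :: "real \<Rightarrow> colour"
  assumes "2 \<le> k" and "k < l"
    and "S = real k * real l + real k - 1"
    and "c 1 = Blue" and "c 2 = Red" and "c (real l + 1) = Red"
  shows "(\<exists>x. mono_solution c S Red k x) \<or> (\<exists>x. mono_solution c S Blue l x)"
proof (rule ccontr)
  assume neg: "\<not> ?thesis"
  define K L where "K = real k" and "L = real l"
  have K: "2 \<le> K" and KL: "K < L"
    using assms(1,2) by (auto simp: K_def L_def)
  have S: "S = K * L + K - 1"
    using assms(3) by (simp add: K_def L_def)
  \<comment> \<open>This bound on the product lets linear reasoning, with \<open>K * L\<close> as an
    atom, place all the numbers used in \<open>{1..S}\<close>.\<close>
  have "2 * L \<le> K * L"
    using K KL by (intro mult_right_mono) auto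
  hence "L + K \<le> K * L"
    using KL by linarith
  hence mem: "1 \<in> {1..S}" "K \<in> {1..S}" "L \<in> {1..S}" "L + 1 \<in> {1..S}" "K * L \<in> {1..S}"
    "S \<in> {1..S}" "(K - 1) * L + K \<in> {1..S}"
    using K KL by (auto simp: S algebra_simps)
  have no_red: False
    if "u \<in> {1..S}" "v \<in> {1..S}" "w \<in> {1..S}" "c u = Red" "c v = Red" "c w = Red"
      "(K - 1) * u + v = w" for u v w
    using ex_mono_solution_two_values[of k u S v w c Red] that neg assms(1)
    by (auto simp: K_def)
  have no_blue: False
    if "u \<in> {1..S}" "v \<in> {1..S}" "w \<in> {1..S}" "c u = Blue" "c v = Blue" "c w = Blue"
      "(L - 1) * u + v = w" for u v w
    using ex_mono_solution_two_values[of l u S v w c Blue] that neg assms(1,2)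
    by (auto simp: L_def)
  have L1: "c (L + 1) = Red"
    using assms(6) by (simp add: L_def)
  \<comment> \<open>If \<open>L\<close> were blue, \<open>l\<close> ones would sum to it.\<close>
  have L: "c L = Red"
    using no_blue[of 1 1 L] mem assms(4) colour_neq_Red_iff by auto
  have "c (K * L) = Blue"
    using no_red[of L L "K * L"] mem L colour_neq_Red_iff by (auto simp: algebra_simps)
  hence "c K = Red"
    using no_blue[of K K "K * L"] mem colour_neq_Red_iff by (auto simp: algebra_simps)
  have "c S = Blue"
    using no_red[of "L + 1" L S] mem L L1 colour_neq_Red_iff by (auto simp: S algebra_simps)
  hence "c ((K - 1) * L + K) = Red"
    using no_blue[of 1 "(K - 1) * L + K" S] mem assms(4) colour_neq_Red_iff
    by (auto simp: S algebra_simps)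
  \<comment> \<open>Red summands, \<open>k - 1\<close> copies of \<open>L\<close> and one
    \<open>K\<close>, now have a red sum.\<close>
  thus False
    using no_red[of L K "(K - 1) * L + K"] mem L \<open>c K = Red\<close> by auto
qed

end
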